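(* If a sequent $\Gamma\vdash\Delta$ is provable in $\mathrm{CLKID}^\omega$, then $\Gamma\vdash\Delta$ is provable in $\mathrm{CLKID}^\omega$ without using the substitution rule $(\mathrm{Subst})$.
   Context: $\mathrm{CLKID}^\omega$ is Brotherston's cyclic-proof system for first-order logic with inductive predicates ($\mathrm{FOL}_{\mathrm{ID}}$). Terms are built from variables and function symbols; formulas are built from inductive predicates $P(\vec t)$, ordinary predicates $Q(\vec u)$, equality $t=u$, $\lnot,\vee,\wedge,\to,\exists,\forall$. Inductive predicates are given by a finite set of productions $P(\vec t)\Leftarrow Q_1(\vec{u_1}),\dots,Q_n(\vec{u_n}),P_1(\vec{t_1}),\dots,P_m(\vec{t_m})$. A sequent is $\Gamma\vdash\Delta$ with $\Gamma,\Delta$ finite sets of formulas. The inference rules of $\mathrm{CLKID}^\omega$ are the usual LK-style rules: $(\mathrm{Axiom})$ (when $\Gamma\cap\Delta\neq\emptyset$), weakening $(\mathrm{Wk})$, $(\mathrm{Cut})$, the substitution rule $(\mathrm{Subst})$ deriving $\Gamma[\theta]\vdash\Delta[\theta]$ from $\Gamma\vdash\Delta$ for any substitution $\theta$ of terms for variables, left/right rules for $\lnot,\vee,\wedge,\to,\forall,\exists$ (with fresh eigenvariables for $(\forall\mathrm{R})$ and $(\exists\mathrm{L})$), equality rules $(=\mathrm{L})$ and $(=\mathrm{R})$, a left unfolding rule $(\mathrm{UL})$ for an inductive predicate $P(\vec u)$ in the antecedent whose premises are all case distinctions $\Gamma,\vec u=\vec t(\vec y),Q_1(\vec{u_1}(\vec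 y)),\dots,P_m(\vec{t_m}(\vec y))\vdash\Delta$ (one for each production of $P$, with $\vec y$ fresh), and a right unfolding rule $(\mathrm{UR})$ for $P$ in the succedent using one production. A pre-proof of $\mathrm{CLKID}^\omega$ is a finite derivation tree in which every non-axiom leaf (a bud) is assigned an internal node (its companion) labelled with a syntactically identical sequent. Paths follow the tree edges plus bud-to-companion edges. A trace along a path is a sequence of inductive-predicate occurrences in the antecedents, following the occurrence through each rule, and it progresses at a point where the occurrence is unfolded by $(\mathrm{UL})$. A pre-proof is a proof if it satisfies the global trace condition: every infinite path has a tail along which some trace progresses infinitely often. *)

theory Defs
  imports Main
begin

text \<open>
  Terms and formulas use de Bruijn indices, so that formulas are identified up to renaming of bound
  variables. A free variable is a natural number; below \<open>n\<close> quantifiers the index \<open>n + i\<close> refers to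
  the free variable \<open>i\<close>.
\<close>

datatype 'f tm = Var nat | Fun 'f "'f tm list"

datatype ('f, 'p, 'q) fm =
    Ind 'p "'f tm list"  \<comment> \<open>inductive predicate\<close>
  | Ord 'q "'f tm list"  \<comment> \<open>ordinary predicate\<close>
  | Eq "'f tm" "'f tm"
  | Neg "('f, 'p, 'q) fm"
  | Disj "('f, 'p, 'q) fm" "('f, 'p, 'q) fm"
  | Conj "('f, 'p, 'q) fm" "('f, 'p, 'q) fm"
  | Imp "('f, 'p, 'q) fm" "('f, 'p, 'q) fm"
  | Exists "('f, 'p, 'q) fm"
  | Forall "('f, 'p, 'q) fm"

type_synonym 'f substitution = "nat \<Rightarrow> 'f tm"

fun fv_tm :: "'f tm \<Rightarrow> nat set" where
  "fv_tm (Var x) = {x}"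
| "fv_tm (Fun f ts) = (\<Union>t\<in>set ts. fv_tm t)"

fun fv :: "('f, 'p, 'q) fm \<Rightarrow> nat set" where
  "fv (Ind P ts) = (\<Union>t\<in>set ts. fv_tm t)"
| "fv (Ord Q ts) = (\<Union>t\<in>set ts. fv_tm t)"
| "fv (Eq t u) = fv_tm t \<union> fv_tm u"
| "fv (Neg F) = fv F"
| "fv (Disj F G) = fv F \<union> fv G"
| "fv (Conj F G) = fv F \<union> fv G"
| "fv (Imp F G) = fv F \<union> fv G"
| "fv (Exists F) = {x. Suc x \<in> fv F}"
| "fv (Forall F) = {x. Suc x \<in> fv F}"

fun subst_tm :: "'f substitution \<Rightarrow> 'f tm \<Rightarrow> 'f tm" where
  "subst_tm \<theta> (Var x) = \<theta> x"
| "subst_tm \<theta> (Fun f ts) = Fun f (map (subst_tm \<theta>) ts)"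

text \<open>The substitution to apply below a quantifier: index \<open>0\<close> is bound, all others are shifted.\<close>

definition lift_subst :: "'f substitution \<Rightarrow> 'f substitution" where
  "lift_subst \<theta> = case_nat (Var 0) (\<lambda>x. subst_tm (\<lambda>y. Var (Suc y)) (\<theta> x))"

fun subst :: "'f substitution \<Rightarrow> ('f, 'p, 'q) fm \<Rightarrow> ('f, 'p, 'q) fm" where
  "subst \<theta> (Ind P ts) = Ind P (map (subst_tm \<theta>) ts)"
| "subst \<theta> (Ord Q ts) = Ord Q (map (subst_tm \<theta>) ts)"
| "subst \<theta> (Eq t u) = Eq (subst_tm \<theta> t) (subst_tm \<theta> u)"
| "subst \<theta> (Neg F) = Neg (subst \<theta> F)"
| "subst \<theta> (Disj F G) = Disj (subst \<theta> F) (subst \<theta> G)"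
| "subst \<theta> (Conj F G) = Conj (subst \<theta> F) (subst \<theta> G)"
| "subst \<theta> (Imp F G) = Imp (subst \<theta> F) (subst \<theta> G)"
| "subst \<theta> (Exists F) = Exists (subst (lift_subst \<theta>) F)"
| "subst \<theta> (Forall F) = Forall (subst (lift_subst \<theta>) F)"

text \<open>The instance \<open>F[t/x]\<close> of a body \<open>F\<close> of \<open>\<forall>x F\<close> or \<open>\<exists>x F\<close>: the bound index \<open>0\<close> becomes \<open>t\<close>.\<close>

definition inst :: "('f, 'p, 'q) fm \<Rightarrow> 'f tm \<Rightarrow> ('f, 'p, 'q) fm" where
  "inst F t = subst (case_nat t Var) F"

text \<open>A production \<open>P(t) \<Leftarrow> Q\<^sub>1(u\<^sub>1), \<dots>, Q\<^sub>n(u\<^sub>n), P\<^sub>1(t\<^sub>1), \<dots>, P\<^sub>m(t\<^sub>m)\<close>.\<close>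

record ('f, 'p, 'q) production =
  head_pred :: 'p
  head_args :: "'f tm list"
  ord_prems :: "('q \<times> 'f tm list) list"
  ind_prems :: "('p \<times> 'f tm list) list"

definition prod_prems :: "('f, 'p, 'q) production \<Rightarrow> ('f, 'p, 'q) fm list" where
  "prod_prems pr = map (\<lambda>(Q, us). Ord Q us) (ord_prems pr) @ map (\<lambda>(P, ts). Ind P ts) (ind_prems pr)"

definition prod_vars :: "('f, 'p, 'q) production \<Rightarrow> nat set" where
  "prod_vars pr = (\<Union>t\<in>set (head_args pr). fv_tm t) \<union> (\<Union>F\<in>set (prod_prems pr). fv F)"

record ('f, 'p, 'q) signature =
  fun_arity :: "'f \<Rightarrow> nat"
  ind_arity :: "'p \<Rightarrow> nat"
  ord_arity :: "'q \<Rightarrow> nat"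
  productions :: "('f, 'p, 'q) production set"

fun wf_tm :: "('f, 'p, 'q) signature \<Rightarrow> 'f tm \<Rightarrow> bool" where
  "wf_tm S (Var x) \<longleftrightarrow> True"
| "wf_tm S (Fun f ts) \<longleftrightarrow> length ts = fun_arity S f \<and> (\<forall>t\<in>set ts. wf_tm S t)"

fun wf_fm :: "('f, 'p, 'q) signature \<Rightarrow> ('f, 'p, 'q) fm \<Rightarrow> bool" where
  "wf_fm S (Ind P ts) \<longleftrightarrow> length ts = ind_arity S P \<and> (\<forall>t\<in>set ts. wf_tm S t)"
| "wf_fm S (Ord Q ts) \<longleftrightarrow> length ts = ord_arity S Q \<and> (\<forall>t\<in>set ts. wf_tm S t)"
| "wf_fm S (Eq t u) \<longleftrightarrow> wf_tm S t \<and> wf_tm S u"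
| "wf_fm S (Neg F) \<longleftrightarrow> wf_fm S F"
| "wf_fm S (Disj F G) \<longleftrightarrow> wf_fm S F \<and> wf_fm S G"
| "wf_fm S (Conj F G) \<longleftrightarrow> wf_fm S F \<and> wf_fm S G"
| "wf_fm S (Imp F G) \<longleftrightarrow> wf_fm S F \<and> wf_fm S G"
| "wf_fm S (Exists F) \<longleftrightarrow> wf_fm S F"
| "wf_fm S (Forall F) \<longleftrightarrow> wf_fm S F"

definition wf_subst :: "('f, 'p, 'q) signature \<Rightarrow> 'f substitution \<Rightarrow> bool" where
  "wf_subst S \<theta> \<longleftrightarrow> (\<forall>x. wf_tm S (\<theta> x))"

definition wf_signature :: "('f, 'p, 'q) signature \<Rightarrow> bool" where
  "wf_signature S \<longleftrightarrow> finite (productions S) \<and>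
     (\<forall>pr\<in>productions S. wf_fm S (Ind (head_pred pr) (head_args pr)) \<and>
        (\<forall>F\<in>set (prod_prems pr). wf_fm S F))"

type_synonym ('f, 'p, 'q) sequent = "('f, 'p, 'q) fm set \<times> ('f, 'p, 'q) fm set"

definition wf_sequent :: "('f, 'p, 'q) signature \<Rightarrow> ('f, 'p, 'q) sequent \<Rightarrow> bool" where
  "wf_sequent S sq \<longleftrightarrow> finite (fst sq) \<and> finite (snd sq) \<and> (\<forall>F\<in>fst sq \<union> snd sq. wf_fm S F)"

definition fv_set :: "('f, 'p, 'q) fm set \<Rightarrow> nat set" where
  "fv_set \<Gamma> = (\<Union>F\<in>\<Gamma>. fv F)"

text \<open>
  Names of rule instances. The arguments record the part of the instance on which traces depend:
  the substitution of \<open>Subst\<close>; \<open>\<Gamma>, x, y, t, u\<close> of \<open>EqL\<close>; and for \<open>UL\<close> the principal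
  formula \<open>P(us)\<close> and, in the order of the premises, the productions of \<open>P\<close>, each with the renaming
  of its variables to the fresh variables of that premise.
\<close>

datatype ('f, 'p, 'q) rule =
    Axiom | Wk | Cut | Subst "'f substitution"
  | NegL | NegR | DisjL | DisjR | ConjL | ConjR | ImpL | ImpR
  | ForallL | ForallR | ExistsL | ExistsR
  | EqL "('f, 'p, 'q) fm set" nat nat "'f tm" "'f tm" | EqR
  | UL 'p "'f tm list" "(('f, 'p, 'q) production \<times> (nat \<Rightarrow> nat)) list" | UR

definition rename_subst :: "(nat \<Rightarrow> nat) \<Rightarrow> 'f substitution" where
  "rename_subst \<rho> = (\<lambda>x. Var (\<rho> x))"

text \<open>
  The formulas \<open>us = t(ys), Q\<^sub>1(u\<^sub>1(ys)), \<dots>, P\<^sub>m(t\<^sub>m(ys))\<close> added by the case distinction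
  for one production.
\<close>

definition case_fms ::
  "'f tm list \<Rightarrow> ('f, 'p, 'q) production \<Rightarrow> (nat \<Rightarrow> nat) \<Rightarrow> ('f, 'p, 'q) fm set" where
  "case_fms us pr \<rho> =
     set (map2 Eq us (map (subst_tm (rename_subst \<rho>)) (head_args pr))) \<union>
     subst (rename_subst \<rho>) ` set (prod_prems pr)"

text \<open>
  \<open>inference S r prems concl\<close>: the rule instance \<open>r\<close> derives \<open>concl\<close> from \<open>prems\<close>. Sequents are
  pairs of sets, so the principal formula may also occur in the context.
\<close>

inductive inference ::
  "('f, 'p, 'q) signature \<Rightarrow> ('f, 'p, 'q) rule \<Rightarrow> ('f, 'p, 'q) sequent list \<Rightarrow>
     ('f, 'p, 'q) sequent \<Rightarrow> bool"
  for S :: "('f, 'p, 'q) signature" where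
  Axiom: "\<Gamma> \<inter> \<Delta> \<noteq> {} \<Longrightarrow> inference S Axiom [] (\<Gamma>, \<Delta>)"
| Wk: "\<Gamma>' \<subseteq> \<Gamma> \<Longrightarrow> \<Delta>' \<subseteq> \<Delta> \<Longrightarrow> inference S Wk [(\<Gamma>', \<Delta>')] (\<Gamma>, \<Delta>)"
| Cut: "inference S Cut [(\<Gamma>, insert F \<Delta>), (insert F \<Gamma>, \<Delta>)] (\<Gamma>, \<Delta>)"
| Subst: "wf_subst S \<theta> \<Longrightarrow> inference S (Subst \<theta>) [(\<Gamma>, \<Delta>)] (subst \<theta> ` \<Gamma>, subst \<theta> ` \<Delta>)"
| NegL: "inference S NegL [(\<Gamma>, insert F \<Delta>)] (insert (Neg F) \<Gamma>, \<Delta>)"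
| NegR: "inference S NegR [(insert F \<Gamma>, \<Delta>)] (\<Gamma>, insert (Neg F) \<Delta>)"
| DisjL: "inference S DisjL [(insert F \<Gamma>, \<Delta>), (insert G \<Gamma>, \<Delta>)] (insert (Disj F G) \<Gamma>, \<Delta>)"
| DisjR: "inference S DisjR [(\<Gamma>, insert F (insert G \<Delta>))] (\<Gamma>, insert (Disj F G) \<Delta>)"
| ConjL: "inference S ConjL [(insert F (insert G \<Gamma>), \<Delta>)] (insert (Conj F G) \<Gamma>, \<Delta>)"
| ConjR: "inference S ConjR [(\<Gamma>, insert F \<Delta>), (\<Gamma>, insert G \<Delta>)] (\<Gamma>, insert (Conj F G) \<Delta>)"
| ImpL: "inference S ImpL [(\<Gamma>, insert F \<Delta>), (insert G \<Gamma>, \<Delta>)] (insert (Imp F G) \<Gamma>, \<Delta>)"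
| ImpR: "inference S ImpR [(insert F \<Gamma>, insert G \<Delta>)] (\<Gamma>, insert (Imp F G) \<Delta>)"
| ForallL: "wf_tm S t \<Longrightarrow>
    inference S ForallL [(insert (inst F t) \<Gamma>, \<Delta>)] (insert (Forall F) \<Gamma>, \<Delta>)"
| ForallR: "y \<notin> fv_set (insert (Forall F) (\<Gamma> \<union> \<Delta>)) \<Longrightarrow>
    inference S ForallR [(\<Gamma>, insert (inst F (Var y)) \<Delta>)] (\<Gamma>, insert (Forall F) \<Delta>)"
| ExistsL: "y \<notin> fv_set (insert (Exists F) (\<Gamma> \<union> \<Delta>)) \<Longrightarrow>
    inference S ExistsL [(insert (inst F (Var y)) \<Gamma>, \<Delta>)] (insert (Exists F) \<Gamma>, \<Delta>)"
| ExistsR: "wf_tm S t \<Longrightarrow>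
    inference S ExistsR [(\<Gamma>, insert (inst F t) \<Delta>)] (\<Gamma>, insert (Exists F) \<Delta>)"
| EqL: "x \<noteq> y \<Longrightarrow>
    inference S (EqL \<Gamma> x y t u)
      [(subst (Var(x := u, y := t)) ` \<Gamma>, subst (Var(x := u, y := t)) ` \<Delta>)]
      (insert (Eq t u) (subst (Var(x := t, y := u)) ` \<Gamma>), subst (Var(x := t, y := u)) ` \<Delta>)"
| EqR: "inference S EqR [] (\<Gamma>, insert (Eq t t) \<Delta>)"
| UL: "distinct (map fst cs) \<Longrightarrow> set (map fst cs) = {pr \<in> productions S. head_pred pr = P} \<Longrightarrow>
    (\<And>pr \<rho>. (pr, \<rho>) \<in> set cs \<Longrightarrow>
       inj_on \<rho> (prod_vars pr) \<and> \<rho> ` prod_vars pr \<inter> fv_set (insert (Ind P us) (\<Gamma> \<union> \<Delta>)) = {}) \<Longrightarrow>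
    inference S (UL P us cs) (map (\<lambda>(pr, \<rho>). (\<Gamma> \<union> case_fms us pr \<rho>, \<Delta>)) cs)
      (insert (Ind P us) \<Gamma>, \<Delta>)"
| UR: "pr \<in> productions S \<Longrightarrow> wf_subst S \<theta> \<Longrightarrow>
    inference S UR (map (\<lambda>F. (\<Gamma>, insert (subst \<theta> F) \<Delta>)) (prod_prems pr))
      (\<Gamma>, insert (subst \<theta> (Ind (head_pred pr) (head_args pr))) \<Delta>)"

text \<open>A \<open>Bud\<close> is a leaf that is not the conclusion of a rule instance.\<close>

datatype ('f, 'p, 'q) dtree =
    Bud "('f, 'p, 'q) sequent"
  | Node "('f, 'p, 'q) sequent" "('f, 'p, 'q) rule" "('f, 'p, 'q) dtree list"

fun root_seq :: "('f, 'p, 'q) dtree \<Rightarrow> ('f, 'p, 'q) sequent" where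
  "root_seq (Bud sq) = sq"
| "root_seq (Node sq r ts) = sq"

fun derivation :: "('f, 'p, 'q) signature \<Rightarrow> ('f, 'p, 'q) dtree \<Rightarrow> bool" where
  "derivation S (Bud sq) \<longleftrightarrow> wf_sequent S sq"
| "derivation S (Node sq r ts) \<longleftrightarrow>
     wf_sequent S sq \<and> inference S r (map root_seq ts) sq \<and> (\<forall>t\<in>set ts. derivation S t)"

fun rules_of :: "('f, 'p, 'q) dtree \<Rightarrow> ('f, 'p, 'q) rule set" where
  "rules_of (Bud sq) = {}"
| "rules_of (Node sq r ts) = insert r (\<Union>t\<in>set ts. rules_of t)"

text \<open>The nodes of a tree are addressed by lists of child indices, starting at the root.\<close>

fun subtree :: "('f, 'p, 'q) dtree \<Rightarrow> nat list \<Rightarrow> ('f, 'p, 'q) dtree option" where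
  "subtree T [] = Some T"
| "subtree (Bud sq) (i # p) = None"
| "subtree (Node sq r ts) (i # p) = (if i < length ts then subtree (ts ! i) p else None)"

text \<open>
  A pre-proof is a derivation tree with a map \<open>R\<close> from the positions of buds to those of their
  companions. A companion is an arbitrary internal node, not necessarily an ancestor of the bud.
\<close>

definition pre_proof ::
  "('f, 'p, 'q) signature \<Rightarrow> ('f, 'p, 'q) dtree \<Rightarrow> (nat list \<Rightarrow> nat list) \<Rightarrow> bool" where
  "pre_proof S T R \<longleftrightarrow> derivation S T \<and>
     (\<forall>p sq. subtree T p = Some (Bud sq) \<longrightarrow>
        (\<exists>r ts. subtree T (R p) = Some (Node sq r ts) \<and> ts \<noteq> []))"

definition edge :: "('f, 'p, 'q) dtree \<Rightarrow> (nat list \<Rightarrow> nat list) \<Rightarrow> nat list \<Rightarrow> nat list \<Rightarrow> bool" where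
  "edge T R p p' \<longleftrightarrow>
     (\<exists>sq. subtree T p = Some (Bud sq) \<and> p' = R p) \<or>
     (\<exists>sq r ts i. subtree T p = Some (Node sq r ts) \<and> i < length ts \<and> p' = p @ [i])"

definition infinite_path ::
  "('f, 'p, 'q) dtree \<Rightarrow> (nat list \<Rightarrow> nat list) \<Rightarrow> (nat \<Rightarrow> nat list) \<Rightarrow> bool" where
  "infinite_path T R \<pi> \<longleftrightarrow> (\<forall>n. edge T R (\<pi> n) (\<pi> (Suc n)))"

text \<open>
  \<open>follows r \<tau> \<tau>'\<close>: the occurrence \<open>\<tau>\<close> in the conclusion of \<open>r\<close> continues, without being unfolded,
  as \<open>\<tau>'\<close> in a premise. \<open>unfolds r i \<tau> \<tau>'\<close>: \<open>\<tau>\<close> is the principal formula of the \<open>UL\<close>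
  instance \<open>r\<close> and \<open>\<tau>'\<close> is one of the inductive predicates \<open>P\<^sub>j(t\<^sub>j(ys))\<close> of the production
  for premise \<open>i\<close>.
\<close>

fun follows :: "('f, 'p, 'q) rule \<Rightarrow> ('f, 'p, 'q) fm \<Rightarrow> ('f, 'p, 'q) fm \<Rightarrow> bool" where
  "follows (Subst \<theta>) \<tau> \<tau>' \<longleftrightarrow> \<tau> = subst \<theta> \<tau>'"
| "follows (EqL \<Gamma> x y t u) \<tau> \<tau>' \<longleftrightarrow>
     (\<exists>F\<in>\<Gamma>. \<tau> = subst (Var(x := t, y := u)) F \<and> \<tau>' = subst (Var(x := u, y := t)) F)"
| "follows r \<tau> \<tau>' \<longleftrightarrow> \<tau> = \<tau>'"

fun unfolds :: "('f, 'p, 'q) rule \<Rightarrow> nat \<Rightarrow> ('f, 'p, 'q) fm \<Rightarrow> ('f, 'p, 'q) fm \<Rightarrow> bool" where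
  "unfolds (UL P us cs) i \<tau> \<tau>' \<longleftrightarrow> \<tau> = Ind P us \<and> i < length cs \<and>
     (\<exists>(P', ts)\<in>set (ind_prems (fst (cs ! i))).
        \<tau>' = subst (rename_subst (snd (cs ! i))) (Ind P' ts))"
| "unfolds r i \<tau> \<tau>' \<longleftrightarrow> False"

definition ind_occurrence :: "('f, 'p, 'q) dtree \<Rightarrow> nat list \<Rightarrow> ('f, 'p, 'q) fm \<Rightarrow> bool" where
  "ind_occurrence T p \<tau> \<longleftrightarrow>
     (\<exists>T'. subtree T p = Some T' \<and> \<tau> \<in> fst (root_seq T')) \<and> (\<exists>P ts. \<tau> = Ind P ts)"

definition progress_step ::
  "('f, 'p, 'q) dtree \<Rightarrow> nat list \<Rightarrow> nat list \<Rightarrow> ('f, 'p, 'q) fm \<Rightarrow> ('f, 'p, 'q) fm \<Rightarrow> bool" where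
  "progress_step T p p' \<tau> \<tau>' \<longleftrightarrow>
     (\<exists>sq r ts i. subtree T p = Some (Node sq r ts) \<and> p' = p @ [i] \<and> unfolds r i \<tau> \<tau>')"

definition trace_step ::
  "('f, 'p, 'q) dtree \<Rightarrow> nat list \<Rightarrow> nat list \<Rightarrow> ('f, 'p, 'q) fm \<Rightarrow> ('f, 'p, 'q) fm \<Rightarrow> bool" where
  "trace_step T p p' \<tau> \<tau>' \<longleftrightarrow>
     (\<exists>sq. subtree T p = Some (Bud sq) \<and> \<tau> = \<tau>') \<or>
     (\<exists>sq r ts. subtree T p = Some (Node sq r ts) \<and> follows r \<tau> \<tau>') \<or>
     progress_step T p p' \<tau> \<tau>'"

definition trace ::
  "('f, 'p, 'q) dtree \<Rightarrow> (nat \<Rightarrow> nat list) \<Rightarrow> (nat \<Rightarrow> ('f, 'p, 'q) fm) \<Rightarrow> bool" where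
  "trace T \<pi> \<tau> \<longleftrightarrow>
     (\<forall>n. ind_occurrence T (\<pi> n) (\<tau> n) \<and> trace_step T (\<pi> n) (\<pi> (Suc n)) (\<tau> n) (\<tau> (Suc n)))"

definition infinitely_progressing ::
  "('f, 'p, 'q) dtree \<Rightarrow> (nat \<Rightarrow> nat list) \<Rightarrow> (nat \<Rightarrow> ('f, 'p, 'q) fm) \<Rightarrow> bool" where
  "infinitely_progressing T \<pi> \<tau> \<longleftrightarrow>
     (\<exists>\<^sub>\<infinity>n. progress_step T (\<pi> n) (\<pi> (Suc n)) (\<tau> n) (\<tau> (Suc n)))"

definition global_trace_condition ::
  "('f, 'p, 'q) dtree \<Rightarrow> (nat list \<Rightarrow> nat list) \<Rightarrow> bool" where
  "global_trace_condition T R \<longleftrightarrow>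
     (\<forall>\<pi>. infinite_path T R \<pi> \<longrightarrow>
        (\<exists>k \<tau>. trace T (\<lambda>n. \<pi> (k + n)) \<tau> \<and> infinitely_progressing T (\<lambda>n. \<pi> (k + n)) \<tau>))"

definition cyclic_proof ::
  "('f, 'p, 'q) signature \<Rightarrow> ('f, 'p, 'q) dtree \<Rightarrow> (nat list \<Rightarrow> nat list) \<Rightarrow> bool" where
  "cyclic_proof S T R \<longleftrightarrow> pre_proof S T R \<and> global_trace_condition T R"

definition provable :: "('f, 'p, 'q) signature \<Rightarrow> ('f, 'p, 'q) sequent \<Rightarrow> bool" where
  "provable S sq \<longleftrightarrow> (\<exists>T R. cyclic_proof S T R \<and> root_seq T = sq)"

definition provable_without_Subst :: "('f, 'p, 'q) signature \<Rightarrow> ('f, 'p, 'q) sequent \<Rightarrow> bool" where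
  "provable_without_Subst S sq \<longleftrightarrow>
     (\<exists>T R. cyclic_proof S T R \<and> root_seq T = sq \<and> (\<forall>\<theta>. Subst \<theta> \<notin> rules_of T))"

end

theory Submission
  imports Defs "HOL-Library.Infinite_Set"
begin

text \<open>
  If \<open>v\<close> does not occur in \<open>t\<close>, then \<open>\<Gamma>[v := t] \<turnstile> \<Delta>[v := t]\<close> follows from \<open>\<Gamma> \<turnstile> \<Delta>\<close> without
  \<open>Subst\<close>: cut with the provable formula \<open>\<exists>x. x = t\<close>, take \<open>v\<close> itself as the eigenvariable of
  \<open>ExistsL\<close>, and rewrite with \<open>v = t\<close> by \<open>EqL\<close>. On finitely many variables every substitution is a
  composition of such replacements: first rename the variables apart, then replace the new variables
  one at a time. So each \<open>Subst\<close> node can be replaced by a finite spine whose side branches have no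
  buds and along which every trace continues. An infinite path of the new tree never enters a side
  branch, hence it is an infinite path of the old tree with finite delays inside the spines, and
  the traces of the old path carry over.
\<close>

section \<open>Substitutions\<close>

definition comp_subst :: "'f substitution \<Rightarrow> 'f substitution \<Rightarrow> 'f substitution" where
  "comp_subst \<sigma> \<theta> = (\<lambda>x. subst_tm \<sigma> (\<theta> x))"

lemma subst_tm_Var [simp]: "subst_tm Var t = t"
  by (induction t) (auto simp: map_idI)

lemma subst_tm_subst_tm: "subst_tm \<sigma> (subst_tm \<theta> t) = subst_tm (comp_subst \<sigma> \<theta>) t"
  by (induction t) (auto simp: comp_subst_def)

lemma subst_tm_cong: "(\<And>x. x \<in> fv_tm t \<Longrightarrow> \<sigma> x = \<theta> x) \<Longrightarrow> subst_tm \<sigma> t = subst_tm \<theta> t"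
  by (induction t) auto

lemma lift_subst_Var [simp]: "lift_subst Var = Var"
  by (auto simp: lift_subst_def fun_eq_iff split: nat.split)

lemma lift_subst_0 [simp]: "lift_subst \<theta> 0 = Var 0"
  and lift_subst_Suc [simp]: "lift_subst \<theta> (Suc x) = subst_tm (\<lambda>y. Var (Suc y)) (\<theta> x)"
  by (auto simp: lift_subst_def)

lemma lift_subst_comp: "lift_subst (comp_subst \<sigma> \<theta>) = comp_subst (lift_subst \<sigma>) (lift_subst \<theta>)"
proof
  fix x
  show "lift_subst (comp_subst \<sigma> \<theta>) x = comp_subst (lift_subst \<sigma>) (lift_subst \<theta>) x"
    by (cases x) (simp_all add: comp_subst_def subst_tm_subst_tm)
qed

lemma subst_Var [simp]: "subst Var F = F"
  by (induction F) (auto simp: map_idI)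

lemma subst_subst: "subst \<sigma> (subst \<theta> F) = subst (comp_subst \<sigma> \<theta>) F"
  by (induction F arbitrary: \<sigma> \<theta>) (auto simp: subst_tm_subst_tm lift_subst_comp)

lemma subst_cong: "(\<And>x. x \<in> fv F \<Longrightarrow> \<sigma> x = \<theta> x) \<Longrightarrow> subst \<sigma> F = subst \<theta> F"
proof (induction F arbitrary: \<sigma> \<theta>)
  case (Exists F)
  have "subst (lift_subst \<sigma>) F = subst (lift_subst \<theta>) F"
  proof (rule Exists.IH)
    fix x assume "x \<in> fv F"
    then show "lift_subst \<sigma> x = lift_subst \<theta> x" using Exists.prems by (cases x) auto
  qed
  then show ?case by simp
next
  case (Forall F)
  have "subst (lift_subst \<sigma>) F = subst (lift_subst \<theta>) F"
  proof (rule Forall.IH)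
    fix x assume "x \<in> fv F"
    then show "lift_subst \<sigma> x = lift_subst \<theta> x" using Forall.prems by (cases x) auto
  qed
  then show ?case by simp
next
  case (Neg F)
  show ?case using Neg.IH[of \<sigma> \<theta>] Neg.prems by simp
next
  case (Disj F G)
  show ?case using Disj.IH[of \<sigma> \<theta>] Disj.prems by simp
next
  case (Conj F G)
  show ?case using Conj.IH[of \<sigma> \<theta>] Conj.prems by simp
next
  case (Imp F G)
  show ?case using Imp.IH[of \<sigma> \<theta>] Imp.prems by simp
qed (auto intro!: subst_tm_cong)

lemma fv_subst_tm: "fv_tm (subst_tm \<theta> t) = (\<Union>x\<in>fv_tm t. fv_tm (\<theta> x))"
  by (induction t) auto

lemma fv_lift_subst: "Suc x \<in> fv_tm (lift_subst \<theta> y) \<longleftrightarrow> (\<exists>z. y = Suc z \<and> x \<in> fv_tm (\<theta> z))"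
  by (cases y) (auto simp: fv_subst_tm)

lemma fv_subst: "fv (subst \<theta> F) = (\<Union>x\<in>fv F. fv_tm (\<theta> x))"
  by (induction F arbitrary: \<theta>) (auto simp: fv_subst_tm fv_lift_subst)

lemma finite_fv_tm [simp]: "finite (fv_tm t)"
  by (induction t) auto

lemma finite_fv [simp]: "finite (fv F)"
  by (induction F) (auto intro: finite_vimageI[of _ Suc, unfolded vimage_def])

lemma finite_fv_set: "finite \<Gamma> \<Longrightarrow> finite (fv_set \<Gamma>)"
  by (auto simp: fv_set_def)

lemma wf_subst_tm: "wf_subst S \<theta> \<Longrightarrow> wf_tm S t \<Longrightarrow> wf_tm S (subst_tm \<theta> t)"
  by (induction t) (auto simp: wf_subst_def)

lemma wf_lift_subst: "wf_subst S \<theta> \<Longrightarrow> wf_subst S (lift_subst \<theta>)"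
  unfolding wf_subst_def by (auto simp: lift_subst_def wf_subst_def intro: wf_subst_tm split: nat.split)

lemma wf_subst_fm: "wf_subst S \<theta> \<Longrightarrow> wf_fm S F \<Longrightarrow> wf_fm S (subst \<theta> F)"
  by (induction F arbitrary: \<theta>) (auto intro: wf_subst_tm wf_lift_subst)

lemma wf_subst_Var [simp]: "wf_subst S Var"
  by (simp add: wf_subst_def)

lemma wf_comp_subst: "wf_subst S \<sigma> \<Longrightarrow> wf_subst S \<theta> \<Longrightarrow> wf_subst S (comp_subst \<sigma> \<theta>)"
  by (simp add: wf_subst_def comp_subst_def wf_subst_tm)

lemma wf_sequent_subst:
  "wf_subst S \<theta> \<Longrightarrow> wf_sequent S (\<Gamma>, \<Delta>) \<Longrightarrow> wf_sequent S (subst \<theta> ` \<Gamma>, subst \<theta> ` \<Delta>)"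
  by (auto simp: wf_sequent_def wf_subst_fm)

section \<open>Decomposition into acyclic replacements of one variable\<close>

text \<open>The latest replacement is applied outermost, since each one is made at the bottom of the
  derivation built so far. \<open>v \<notin> fv_tm t\<close> is what makes \<open>v\<close>
  admissible as an eigenvariable.\<close>

inductive acyclic_comp :: "('f, 'p, 'q) signature \<Rightarrow> 'f substitution \<Rightarrow> bool" for S where
  acyclic_Var: "acyclic_comp S Var"
| acyclic_step: "acyclic_comp S \<sigma> \<Longrightarrow> v \<notin> fv_tm t \<Longrightarrow> wf_tm S t \<Longrightarrow>
    acyclic_comp S (comp_subst (Var(v := t)) \<sigma>)"

lemma comp_subst_assoc: "comp_subst (comp_subst \<sigma> \<theta>) \<tau> = comp_subst \<sigma> (comp_subst \<theta> \<tau>)"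
  by (simp add: comp_subst_def subst_tm_subst_tm fun_eq_iff)

lemma comp_subst_Var [simp]: "comp_subst Var \<sigma> = \<sigma>"
  by (simp add: comp_subst_def)

lemma acyclic_comp_comp:
  "acyclic_comp S \<sigma> \<Longrightarrow> acyclic_comp S \<theta> \<Longrightarrow> acyclic_comp S (comp_subst \<sigma> \<theta>)"
  by (induction rule: acyclic_comp.induct) (auto simp: comp_subst_assoc intro: acyclic_step)

lemma acyclic_comp_wf: "acyclic_comp S \<sigma> \<Longrightarrow> wf_subst S \<sigma>"
  by (induction rule: acyclic_comp.induct) (auto simp: wf_subst_def comp_subst_def intro!: wf_subst_tm)

text \<open>No replacing term contains a variable of \<open>X\<close>, so later replacements leave
  the terms already inserted intact, and the successive replacements amount to the simultaneous
  one.\<close>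

lemma acyclic_comp_disjoint:
  assumes "finite X" and "\<And>x. x \<in> X \<Longrightarrow> wf_tm S (\<theta> x) \<and> fv_tm (\<theta> x) \<inter> X = {}"
  shows "acyclic_comp S (\<lambda>x. if x \<in> X then \<theta> x else Var x)"
  using assms
proof (induction X rule: finite_induct)
  case empty
  then show ?case using acyclic_Var by (simp add: fun_eq_iff)
next
  case (insert x X)
  let ?\<sigma> = "\<lambda>x. if x \<in> X then \<theta> x else Var x"
  have "acyclic_comp S ?\<sigma>" using insert by blast
  moreover have "x \<notin> fv_tm (\<theta> x)" "wf_tm S (\<theta> x)" using insert.prems by auto
  ultimately have "acyclic_comp S (comp_subst (Var(x := \<theta> x)) ?\<sigma>)" by (rule acyclic_step)
  moreover have "subst_tm (Var(x := \<theta> x)) (\<theta> y) = \<theta> y" if "y \<in> X" for y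
  proof -
    have "subst_tm (Var(x := \<theta> x)) (\<theta> y) = subst_tm Var (\<theta> y)"
      using insert.prems[of y] that by (intro subst_tm_cong) auto
    then show ?thesis by simp
  qed
  then have "comp_subst (Var(x := \<theta> x)) ?\<sigma> = (\<lambda>y. if y \<in> insert x X then \<theta> y else Var y)"
    using insert.hyps by (auto simp: comp_subst_def fun_eq_iff)
  ultimately show ?case by metis
qed

text \<open>A swap, or a substitution with \<open>x\<close> in \<open>\<theta> x\<close>, is no
  disjoint replacement itself; passing through new names removes the overlap. Agreement on a finite
  \<open>X\<close> suffices for a sequent.\<close>

lemma acyclic_comp_exists:
  assumes fin: "finite X" and wf: "wf_subst S \<theta>"
  obtains \<sigma> where "acyclic_comp S \<sigma>" "\<And>x. x \<in> X \<Longrightarrow> \<sigma> x = \<theta> x"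
proof -
  have "finite (X \<union> (\<Union>x\<in>X. fv_tm (\<theta> x)))" using fin by auto
  \<comment> \<open>\<open>N\<close> exceeds the variables in \<open>X\<close> and those of their
    images, so the names \<open>x + N\<close> are new with respect to both.\<close>
  then obtain N where N: "\<forall>x \<in> X \<union> (\<Union>x\<in>X. fv_tm (\<theta> x)). x < N"
    using finite_nat_set_iff_bounded by meson
  define \<rho> :: "'a substitution" where "\<rho> = (\<lambda>x. if x \<in> X then Var (x + N) else Var x)"
  \<comment> \<open>\<open>\<eta>\<close> undoes the shift and inserts the intended terms; their
    variables lie below \<open>N\<close>, hence outside the shifted names.\<close>
  define \<eta> where "\<eta> = (\<lambda>x. if x \<in> (\<lambda>x. x + N) ` X then \<theta> (x - N) else Var x)"
  have "acyclic_comp S \<rho>"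
    unfolding \<rho>_def using fin N by (intro acyclic_comp_disjoint) auto
  moreover have "acyclic_comp S \<eta>"
    unfolding \<eta>_def
  proof (rule acyclic_comp_disjoint)
    fix z assume "z \<in> (\<lambda>x. x + N) ` X"
    then obtain x where x: "x \<in> X" "z = x + N" by auto
    then have "\<forall>y\<in>fv_tm (\<theta> x). y < N" using N by auto
    then show "wf_tm S (\<theta> (z - N)) \<and> fv_tm (\<theta> (z - N)) \<inter> (\<lambda>x. x + N) ` X = {}"
      using wf x by (auto simp: wf_subst_def)
  qed (use fin in auto)
  moreover have "comp_subst \<eta> \<rho> x = \<theta> x" if "x \<in> X" for x
    using that by (auto simp: comp_subst_def \<rho>_def \<eta>_def)
  ultimately show thesis using that acyclic_comp_comp by blast
qed

section \<open>Spines\<close>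

text \<open>A path that enters a tree without buds can never jump back and must end; hence side
  branches cannot affect the global trace condition.\<close>

fun bud_free :: "('f, 'p, 'q) dtree \<Rightarrow> bool" where
  "bud_free (Bud sq) \<longleftrightarrow> False"
| "bud_free (Node sq r ts) \<longleftrightarrow> (\<forall>t\<in>set ts. bud_free t)"

text \<open>
  A frame is a node with one child removed. Its substitution sends each antecedent formula of the
  sequent in the hole of the spine to the formula it is traced from in the sequent of the frame.
\<close>

datatype ('f, 'p, 'q) frame = Frame "('f, 'p, 'q) sequent" "('f, 'p, 'q) rule"
  (left: "('f, 'p, 'q) dtree list") "('f, 'p, 'q) dtree list" "'f substitution"

fun plug :: "('f, 'p, 'q) frame list \<Rightarrow> ('f, 'p, 'q) dtree \<Rightarrow> ('f, 'p, 'q) dtree" where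
  "plug [] t = t"
| "plug (Frame sq r us vs \<sigma> # fs) t = Node sq r (us @ plug fs t # vs)"

fun spine_subst :: "('f, 'p, 'q) frame list \<Rightarrow> 'f substitution" where
  "spine_subst [] = Var"
| "spine_subst (Frame sq r us vs \<sigma> # fs) = \<sigma>"

fun spine_seq :: "('f, 'p, 'q) sequent \<Rightarrow> ('f, 'p, 'q) frame list \<Rightarrow> ('f, 'p, 'q) sequent" where
  "spine_seq sq [] = sq"
| "spine_seq sq (Frame sq' r us vs \<sigma> # fs) = sq'"

definition side_tree :: "('f, 'p, 'q) signature \<Rightarrow> ('f, 'p, 'q) dtree \<Rightarrow> bool" where
  "side_tree S t \<longleftrightarrow> derivation S t \<and> bud_free t \<and> (\<forall>\<theta>. Subst \<theta> \<notin> rules_of t)"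

text \<open>\<open>sq\<close> is the sequent in the hole. By the last conjunct, a formula
  \<open>F\<close> of its antecedent can be followed, through its images frame by frame, from the
  bottom of the spine up to \<open>F\<close> itself in the hole.\<close>

fun spine :: "('f, 'p, 'q) signature \<Rightarrow> ('f, 'p, 'q) sequent \<Rightarrow> ('f, 'p, 'q) frame list \<Rightarrow> bool" where
  "spine S sq [] \<longleftrightarrow> True"
| "spine S sq (Frame sq' r us vs \<sigma> # fs) \<longleftrightarrow> spine S sq fs \<and> wf_sequent S sq' \<and>
     inference S r (map root_seq us @ spine_seq sq fs # map root_seq vs) sq' \<and>
     (\<forall>\<theta>. r \<noteq> Subst \<theta>) \<and> (\<forall>t\<in>set us \<union> set vs. side_tree S t) \<and>
     (\<forall>F\<in>fst sq. subst \<sigma> F \<in> fst sq' \<and> follows r (subst \<sigma> F) (subst (spine_subst fs) F))"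

lemma root_seq_plug: "root_seq (plug fs t) = spine_seq (root_seq t) fs"
  by (cases "(root_seq t, fs)" rule: spine_seq.cases) auto

lemma spine_subst_mem: "spine S sq fs \<Longrightarrow> F \<in> fst sq \<Longrightarrow> subst (spine_subst fs) F \<in> fst (spine_seq sq fs)"
  by (cases "(sq, fs)" rule: spine_seq.cases) auto

lemma derivation_plug:
  "spine S (root_seq t) fs \<Longrightarrow> derivation S t \<Longrightarrow> derivation S (plug fs t)"
proof (induction fs)
  case (Cons f fs)
  then show ?case by (cases f) (auto simp: root_seq_plug side_tree_def)
qed simp

lemma rules_of_plug:
  "spine S sq fs \<Longrightarrow> Subst \<theta> \<notin> rules_of t \<Longrightarrow> Subst \<theta> \<notin> rules_of (plug fs t)"
proof (induction fs)
  case (Cons f fs)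
  then show ?case by (cases f) (auto simp: side_tree_def)
qed simp

text \<open>Three rules are added below the spine: \<open>EqL\<close> passes to the instance with
  the extra hypothesis \<open>v = t\<close>, \<open>ExistsL\<close> turns this hypothesis into
  \<open>\<exists>x. x = t\<close>, and \<open>Cut\<close> removes it.\<close>

lemma spine_step:
  fixes S :: "('f, 'p, 'q) signature"
  assumes sp: "spine S (\<Gamma>, \<Delta>) fs" and seq: "spine_seq (\<Gamma>, \<Delta>) fs = (subst \<sigma> ` \<Gamma>, subst \<sigma> ` \<Delta>)"
    and \<sigma>: "spine_subst fs = \<sigma>" and wf\<sigma>: "wf_subst S \<sigma>" and wf: "wf_sequent S (\<Gamma>, \<Delta>)"
    and v: "v \<notin> fv_tm t" and t: "wf_tm S t"
  defines "\<theta> \<equiv> comp_subst (Var(v := t)) \<sigma>"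
  obtains fs' where "spine S (\<Gamma>, \<Delta>) fs'" "spine_seq (\<Gamma>, \<Delta>) fs' = (subst \<theta> ` \<Gamma>, subst \<theta> ` \<Delta>)"
    "spine_subst fs' = \<theta>"
proof -
  define A where "A = subst \<sigma> ` \<Gamma>"
  define B where "B = subst \<sigma> ` \<Delta>"
  define A' where "A' = subst \<theta> ` \<Gamma>"
  define B' where "B' = subst \<theta> ` \<Delta>"
  have A': "A' = subst (Var(v := t)) ` A" and B': "B' = subst (Var(v := t)) ` B"
    by (auto simp: A_def A'_def B_def B'_def \<theta>_def subst_subst image_image)
  have wf\<theta>: "wf_subst S \<theta>"
    unfolding \<theta>_def using wf\<sigma> t by (intro wf_comp_subst) (auto simp: wf_subst_def)
  have wfA: "wf_sequent S (A, B)" and wfA': "wf_sequent S (A', B')"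
    unfolding A_def B_def A'_def B'_def using wf wf\<sigma> wf\<theta> by (auto intro: wf_sequent_subst)
  \<comment> \<open>The body of \<open>\<exists>x. x = t\<close>; \<open>t\<close> is shifted to
    stay clear of the bound index \<open>0\<close>.\<close>
  define E :: "('f, 'p, 'q) fm"
    where "E = Eq (Var 0) (subst_tm (\<lambda>y. Var (Suc y)) t)"
  have inst_E: "inst E u = Eq u t" for u
    by (simp add: inst_def E_def subst_tm_subst_tm comp_subst_def)
  have wf_shift: "wf_tm S (subst_tm (\<lambda>y. Var (Suc y)) t)"
    using t by (intro wf_subst_tm) (auto simp: wf_subst_def)
  \<comment> \<open>The replacement eliminates \<open>v\<close> from the conclusion, which is why
    \<open>v\<close> itself can serve as the eigenvariable of \<open>ExistsL\<close>.\<close>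
  have fresh: "v \<notin> fv (subst (Var(v := t)) F)" for F :: "('f, 'p, 'q) fm"
    using v by (auto simp: fv_subst)
  \<comment> \<open>\<open>EqL\<close> acts on two distinct variables; with the first one fresh,
    only the replacement at \<open>v\<close> has an effect.\<close>
  have "finite (insert v (fv_set (A \<union> B)))"
    using wfA by (auto simp: wf_sequent_def intro: finite_fv_set)
  then obtain x where x: "x \<notin> insert v (fv_set (A \<union> B))"
    using ex_new_if_finite infinite_UNIV_nat by blast
  have eq_concl: "subst (Var(x := Var v, v := t)) F = subst (Var(v := t)) F"
    and eq_prem: "subst (Var(x := t, v := Var v)) F = F" if "F \<in> A \<union> B" for F
  proof -
    have x': "x \<notin> fv F" using x that by (auto simp: fv_set_def)
    then show "subst (Var(x := Var v, v := t)) F = subst (Var(v := t)) F"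
      by (intro subst_cong) auto
    have "subst (Var(x := t, v := Var v)) F = subst Var F"
      using x' by (intro subst_cong) auto
    then show "subst (Var(x := t, v := Var v)) F = F" by simp
  qed
  have wf_E: "wf_fm S E" using wf_shift by (simp add: E_def)
  have exR: "inference S ExistsR [(A', insert (Eq t t) B')] (A', insert (Exists E) B')"
    using inference.ExistsR[OF t, of A' E B'] by (simp add: inst_E)
  \<comment> \<open>The left premise of the cut: \<open>t\<close> is its own witness, as
    \<open>t = t\<close> holds by \<open>EqR\<close>.\<close>
  define side where
    "side = Node (A', insert (Exists E) B') ExistsR [Node (A', insert (Eq t t) B') EqR []]"
  have side: "side_tree S side"
    using wfA' t wf_E exR inference.EqR[of S A' t B']
    by (auto simp: side_tree_def side_def wf_sequent_def)
  \<comment> \<open>Listed from the bottom upwards. All three frames carry \<open>\<theta>\<close>: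
    \<open>Cut\<close> and \<open>ExistsL\<close> leave the context alone, and the change from
    \<open>\<theta>\<close> to \<open>\<sigma>\<close> happens across \<open>EqL\<close>.\<close>
  define fs' where "fs' =
    Frame (A', B') Cut [side] [] \<theta> #
    Frame (insert (Exists E) A', B') ExistsL [] [] \<theta> #
    Frame (insert (Eq (Var v) t) A', B') (EqL A x v (Var v) t) [] [] \<theta> # fs"
  have cut: "inference S Cut [(A', insert (Exists E) B'), (insert (Exists E) A', B')] (A', B')"
    by (rule inference.Cut)
  have exL: "inference S ExistsL [(insert (Eq (Var v) t) A', B')] (insert (Exists E) A', B')"
    unfolding inst_E[symmetric]
  proof (rule inference.ExistsL)
    show "v \<notin> fv_set (insert (Exists E) (A' \<union> B'))"
      using v fresh by (auto simp: fv_set_def E_def A' B' fv_subst_tm split: if_splits)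
  qed
  have "subst (Var(x := t, v := Var v)) ` A = A" "subst (Var(x := t, v := Var v)) ` B = B"
    "subst (Var(x := Var v, v := t)) ` A = A'" "subst (Var(x := Var v, v := t)) ` B = B'"
    using eq_prem eq_concl by (auto simp: A' B' image_iff)
  then have eqL: "inference S (EqL A x v (Var v) t) [(A, B)] (insert (Eq (Var v) t) A', B')"
    using inference.EqL[of x v S A "Var v" t B] x by simp
  have follows: "follows (EqL A x v (Var v) t) (subst \<theta> F) (subst \<sigma> F)" if "F \<in> \<Gamma>" for F
  proof -
    have F: "subst \<sigma> F \<in> A" "subst \<theta> F = subst (Var(v := t)) (subst \<sigma> F)"
      using that by (auto simp: A_def \<theta>_def subst_subst)
    then show ?thesis using eq_concl eq_prem by (auto intro!: bexI[of _ "subst \<sigma> F"])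
  qed
  have "spine S (\<Gamma>, \<Delta>) fs'"
    using sp cut exL eqL side wfA' t wf_E \<sigma> follows seq
    by (auto simp: fs'_def side_def A_def[symmetric] B_def[symmetric] wf_sequent_def A'_def)
  then show thesis
    by (rule that) (simp_all add: fs'_def A'_def B'_def)
qed

lemma spine_acyclic:
  assumes "acyclic_comp S \<sigma>" and wf: "wf_sequent S (\<Gamma>, \<Delta>)"
  shows "\<exists>fs. spine S (\<Gamma>, \<Delta>) fs \<and> spine_seq (\<Gamma>, \<Delta>) fs = (subst \<sigma> ` \<Gamma>, subst \<sigma> ` \<Delta>) \<and>
    spine_subst fs = \<sigma>"
  using assms(1)
proof (induction rule: acyclic_comp.induct)
  case acyclic_Var
  show ?case by (intro exI[of _ "[]"]) simp
next
  case (acyclic_step \<sigma> v t)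
  then show ?case using spine_step[OF _ _ _ acyclic_comp_wf wf] by metis
qed

text \<open>
  The spine is not empty because the node it replaces may be a companion whose premise is a bud.
\<close>

lemma spine_exists:
  assumes wf: "wf_sequent S (\<Gamma>, \<Delta>)" and \<theta>: "wf_subst S \<theta>"
  shows "\<exists>fs. fs \<noteq> [] \<and> spine S (\<Gamma>, \<Delta>) fs \<and>
    spine_seq (\<Gamma>, \<Delta>) fs = (subst \<theta> ` \<Gamma>, subst \<theta> ` \<Delta>) \<and> spine_subst fs = \<theta>"
proof -
  have "finite (fv_set (\<Gamma> \<union> \<Delta>))" using wf by (auto simp: wf_sequent_def intro: finite_fv_set)
  then obtain \<sigma> where \<sigma>: "acyclic_comp S \<sigma>" "\<And>x. x \<in> fv_set (\<Gamma> \<union> \<Delta>) \<Longrightarrow> \<sigma> x = \<theta> x"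
    using acyclic_comp_exists[OF _ \<theta>] by metis
  have eq: "subst \<sigma> F = subst \<theta> F" if "F \<in> \<Gamma> \<union> \<Delta>" for F
    using \<sigma>(2) that by (intro subst_cong) (auto simp: fv_set_def)
  obtain fs where fs: "spine S (\<Gamma>, \<Delta>) fs" "spine_subst fs = \<sigma>"
    "spine_seq (\<Gamma>, \<Delta>) fs = (subst \<sigma> ` \<Gamma>, subst \<sigma> ` \<Delta>)"
    using spine_acyclic[OF \<sigma>(1) wf] by blast
  have img: "subst \<sigma> ` \<Gamma> = subst \<theta> ` \<Gamma>" "subst \<sigma> ` \<Delta> = subst \<theta> ` \<Delta>"
    using eq by (auto intro!: image_cong)
  have seq: "spine_seq (\<Gamma>, \<Delta>) fs = (subst \<theta> ` \<Gamma>, subst \<theta> ` \<Delta>)"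
    using fs(3) img by simp
  \<comment> \<open>This \<open>Wk\<close> repeats its sequent. Its frame carries
    \<open>\<theta>\<close> instead of \<open>\<sigma>\<close>, which is sound because both act
    alike on the formulas of the sequent.\<close>
  let ?fs = "Frame (subst \<theta> ` \<Gamma>, subst \<theta> ` \<Delta>) Wk [] [] \<theta> # fs"
  have sp: "spine S (\<Gamma>, \<Delta>) ?fs"
    using fs(1) wf_sequent_subst[OF \<theta> wf] by (auto simp: seq fs(2) eq intro: inference.Wk)
  show ?thesis
  proof (intro exI conjI)
    show "spine S (\<Gamma>, \<Delta>) ?fs" by (rule sp)
  qed simp_all
qed

section \<open>Replacing the substitution rule by spines\<close>

text \<open>The choice is fixed once, so that the translated tree and the reading of its positions
  refer to the same spine.\<close>

definition node_spine ::
  "('f, 'p, 'q) signature \<Rightarrow> 'f substitution \<Rightarrow> ('f, 'p, 'q) sequent \<Rightarrow> ('f, 'p, 'q) frame list" where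
  "node_spine S \<theta> sq = (SOME fs. fs \<noteq> [] \<and> spine S sq fs \<and>
    spine_seq sq fs = (subst \<theta> ` fst sq, subst \<theta> ` snd sq) \<and> spine_subst fs = \<theta>)"

lemma node_spine:
  assumes "wf_sequent S sq" and "wf_subst S \<theta>"
  shows "node_spine S \<theta> sq \<noteq> []" "spine S sq (node_spine S \<theta> sq)"
    "spine_seq sq (node_spine S \<theta> sq) = (subst \<theta> ` fst sq, subst \<theta> ` snd sq)"
    "spine_subst (node_spine S \<theta> sq) = \<theta>"
  using someI_ex[OF spine_exists[of S "fst sq" "snd sq" \<theta>]] assms
  by (simp_all add: node_spine_def)

fun subst_of :: "('f, 'p, 'q) rule \<Rightarrow> 'f substitution option" where
  "subst_of (Subst \<theta>) = Some \<theta>"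
| "subst_of _ = None"

lemma subst_of_Some: "subst_of r = Some \<theta> \<longleftrightarrow> r = Subst \<theta>"
  by (cases r) auto

text \<open>In the \<open>Subst\<close> case \<open>hd\<close> is taken after the recursive calls,
  so that these range over members of \<open>ts\<close>, which gives termination.\<close>

fun elim_Subst :: "('f, 'p, 'q) signature \<Rightarrow> ('f, 'p, 'q) dtree \<Rightarrow> ('f, 'p, 'q) dtree" where
  "elim_Subst S (Bud sq) = Bud sq"
| "elim_Subst S (Node sq r ts) = (case subst_of r of
     Some \<theta> \<Rightarrow> plug (node_spine S \<theta> (root_seq (hd ts))) (hd (map (elim_Subst S) ts))
   | None \<Rightarrow> Node sq r (map (elim_Subst S) ts))"

lemma wf_sequent_root: "derivation S t \<Longrightarrow> wf_sequent S (root_seq t)"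
  by (cases t) auto

lemma derivation_Subst:
  assumes "derivation S (Node sq (Subst \<theta>) ts)"
  obtains t where "ts = [t]" "derivation S t" "wf_subst S \<theta>"
    "sq = (subst \<theta> ` fst (root_seq t), subst \<theta> ` snd (root_seq t))"
  using assms by (auto elim!: inference.cases simp: map_eq_Cons_conv prod_eq_iff)

lemma elim_Subst_Node:
  "subst_of r = None \<Longrightarrow> elim_Subst S (Node sq r ts) = Node sq r (map (elim_Subst S) ts)"
  by simp

lemma elim_Subst_Subst:
  "elim_Subst S (Node sq (Subst \<theta>) [t]) = plug (node_spine S \<theta> (root_seq t)) (elim_Subst S t)"
  by simp

text \<open>Since root sequents are preserved, the instances of the other rules stay valid over the
  translated premises.\<close>

lemma elim_Subst_correct:
  "derivation S t \<Longrightarrow> derivation S (elim_Subst S t) \<and> root_seq (elim_Subst S t) = root_seq t \<and>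
    (\<forall>\<theta>. Subst \<theta> \<notin> rules_of (elim_Subst S t))"
proof (induction t)
  case (Node sq r ts)
  show ?case
  proof (cases "subst_of r")
    case None
    have eq: "map root_seq (map (elim_Subst S) ts) = map root_seq ts"
      using Node by (auto intro!: map_cong)
    have "inference S r (map root_seq (map (elim_Subst S) ts)) sq"
      unfolding eq using Node.prems by simp
    moreover have "r \<noteq> Subst \<theta>" for \<theta> using None by auto
    ultimately show ?thesis
      using Node unfolding elim_Subst_Node[OF None] by (auto simp del: elim_Subst.simps)
  next
    case (Some \<theta>)
    then have r: "r = Subst \<theta>" by (simp add: subst_of_Some)
    with Node.prems obtain t where t: "ts = [t]" "derivation S t" "wf_subst S \<theta>"
      "sq = (subst \<theta> ` fst (root_seq t), subst \<theta> ` snd (root_seq t))"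
      using derivation_Subst by metis
    note sp = node_spine[OF wf_sequent_root[OF t(2)] t(3)]
    have IH: "derivation S (elim_Subst S t)" "root_seq (elim_Subst S t) = root_seq t"
      "\<forall>\<theta>. Subst \<theta> \<notin> rules_of (elim_Subst S t)"
      using Node.IH[of t] t by auto
    show ?thesis
      unfolding r t(1) elim_Subst_Subst
      using sp IH derivation_plug[of S "elim_Subst S t"] rules_of_plug[of S "root_seq t"] t(4)
      by (auto simp: root_seq_plug)
  qed
qed simp

section \<open>Positions and infinite paths\<close>

lemma subtree_snoc: "subtree T (p @ [i]) = (case subtree T p of
    Some (Node sq r ts) \<Rightarrow> if i < length ts then Some (ts ! i) else None | _ \<Rightarrow> None)"
  by (induction T p rule: subtree.induct) (auto split: dtree.splits)

lemma derivation_subtree: "derivation S T \<Longrightarrow> subtree T p = Some V \<Longrightarrow> derivation S V"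
  by (induction T p rule: subtree.induct) (auto split: if_splits)

text \<open>Without buds every edge leads to a child, so induction on the finite subtree bounds the
  path.\<close>

lemma bud_free_no_infinite_path:
  "subtree T (\<pi> n) = Some U \<Longrightarrow> bud_free U \<Longrightarrow> infinite_path T R \<pi> \<Longrightarrow> False"
proof (induction U arbitrary: n)
  case (Node sq r ts)
  then have "edge T R (\<pi> n) (\<pi> (Suc n))" by (simp add: infinite_path_def)
  with Node.prems obtain i where "i < length ts" "\<pi> (Suc n) = \<pi> n @ [i]"
    by (auto simp: edge_def)
  with Node.prems Node.IH[of "ts ! i" "Suc n"] show ?case by (auto simp: subtree_snoc)
qed simp

text \<open>\<open>A\<close> is the set of times at which the sequence may move. Deleting the
  waiting times leaves \<open>\<pi>\<close>, and \<open>idx\<close> tells how far in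
  \<open>\<pi>\<close> a given time has come. Recurrence of \<open>A\<close> makes every index of
  \<open>\<pi>\<close> be reached.\<close>

lemma destutter:
  fixes q :: "nat \<Rightarrow> 'a"
  assumes inf: "\<And>m. \<exists>n\<ge>m. n \<in> A" and stutter: "\<And>n. n \<notin> A \<Longrightarrow> q (Suc n) = q n"
  obtains idx :: "nat \<Rightarrow> nat" and \<pi> where "\<And>n. \<pi> (idx n) = q n"
    "\<And>n. idx (Suc n) = (if n \<in> A then Suc (idx n) else idx n)" "\<And>k. \<exists>n\<in>A. idx n = k"
proof -
  \<comment> \<open>Only moves strictly before time \<open>n\<close> count, so a move made at
    \<open>n\<close> shows first at \<open>Suc n\<close>.\<close>
  define idx where "idx = (\<lambda>n. card (A \<inter> {..<n}))"
  have idx_Suc: "idx (Suc n) = (if n \<in> A then Suc (idx n) else idx n)" for n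
    by (simp add: idx_def lessThan_Suc)
  have mono: "idx m \<le> idx n" if "m \<le> n" for m n
    using that by (rule lift_Suc_mono_le[of idx, rotated]) (auto simp: idx_Suc)
  have next_A: "\<exists>n\<in>A. idx n = idx m" for m
  proof -
    \<comment> \<open>The waiting time from \<open>m\<close> to the next move, during which the
      count is constant.\<close>
    define d where "d = (LEAST d. m + d \<in> A)"
    have "\<exists>d. m + d \<in> A" using inf[of m] le_Suc_ex by blast
    then have "m + d \<in> A" unfolding d_def by (rule LeastI_ex)
    moreover have "idx (m + e) = idx m" if "e \<le> d" for e
      using that
    proof (induction e)
      case (Suc e)
      then have "m + e \<notin> A" unfolding d_def using not_less_Least[of e "\<lambda>d. m + d \<in> A"] by auto
      then show ?case using Suc idx_Suc by simp
    qed simp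
    ultimately show ?thesis by blast
  qed
  have surj: "\<exists>n\<in>A. idx n = k" for k
  proof (induction k)
    case 0
    then show ?case using next_A[of 0] by (simp add: idx_def)
  next
    case (Suc k)
    then obtain n where "n \<in> A" "idx n = k" by blast
    then show ?case using next_A[of "Suc n"] by (simp add: idx_Suc)
  qed
  have eq: "q (n + d) = q n" if "idx (n + d) = idx n" for n d
    using that
  proof (induction d)
    case (Suc d)
    have "idx n \<le> idx (n + d)" "idx (n + d) \<le> idx (n + Suc d)" by (auto intro: mono)
    then have "idx (n + d) = idx n" "n + d \<notin> A"
      using Suc.prems idx_Suc[of "n + d"] by (auto split: if_splits)
    then show ?case using Suc.IH stutter by simp
  qed simp
  \<comment> \<open>Times with equal count have equal values of \<open>q\<close>, so any
    representative may define \<open>\<pi>\<close>.\<close>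
  have "q (SOME m. idx m = idx n) = q n" for n
  proof -
    have "idx (SOME m. idx m = idx n) = idx n" by (rule someI) simp
    then show ?thesis using eq le_Suc_ex nle_le by metis
  qed
  then show thesis using that[of "\<lambda>k. q (SOME m. idx m = k)" idx] idx_Suc surj by blast
qed

section \<open>States of positions in the new tree\<close>

text \<open>
  A position of the new tree is read from the root downwards; the state consists of a position in
  the old tree and the frames still to be passed before its translated subtree is reached. Outside
  of the translated nodes and the spines the state is \<open>None\<close>.
\<close>

type_synonym ('f, 'p, 'q) state = "nat list \<times> ('f, 'p, 'q) frame list"

fun descend ::
  "nat list \<Rightarrow> ('f, 'p, 'q) frame list \<Rightarrow> nat \<Rightarrow> ('f, 'p, 'q) state option" where
  "descend q [] i = None"
| "descend q (f # fs) i = (if i = length (left f) then Some (q, fs) else None)"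

text \<open>At a \<open>Subst\<close> node \<open>q\<close> the state \<open>(q, [])\<close> stands
  for the bottom of its spine. The first step up the spine already moves the old position to
  \<open>q @ [0]\<close>; the remaining steps keep it.\<close>

definition child_state ::
  "('f, 'p, 'q) signature \<Rightarrow> ('f, 'p, 'q) dtree \<Rightarrow> ('f, 'p, 'q) state \<Rightarrow> nat \<Rightarrow>
     ('f, 'p, 'q) state option" where
  "child_state S T st i = (case st of (q, fs) \<Rightarrow> if fs \<noteq> [] then descend q fs i else
     (case subtree T q of
        Some (Node sq r ts) \<Rightarrow> (case subst_of r of
            Some \<theta> \<Rightarrow> descend (q @ [0]) (node_spine S \<theta> (root_seq (hd ts))) i
          | None \<Rightarrow> Some (q @ [i], []))
      | _ \<Rightarrow> None))"

definition locate ::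
  "('f, 'p, 'q) signature \<Rightarrow> ('f, 'p, 'q) dtree \<Rightarrow> nat list \<Rightarrow> ('f, 'p, 'q) state option" where
  "locate S T = foldl (\<lambda>st i. Option.bind st (\<lambda>st. child_state S T st i)) (Some ([], []))"

lemma locate_Nil [simp]: "locate S T [] = Some ([], [])"
  and locate_snoc: "locate S T (p @ [i]) = Option.bind (locate S T p) (\<lambda>st. child_state S T st i)"
  by (simp_all add: locate_def)

lemma plug_eq_Bud: "plug fs t = Bud sq \<longleftrightarrow> fs = [] \<and> t = Bud sq"
  by (cases "(fs, t)" rule: plug.cases) auto

lemma descend_child:
  assumes "spine S sq fs" and "plug fs t = Node sq' r ts" and "fs \<noteq> []" and "i < length ts"
  shows "case descend q fs i of
      None \<Rightarrow> bud_free (ts ! i)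
    | Some (q', fs') \<Rightarrow> q' = q \<and> ts ! i = plug fs' t \<and> spine S sq fs' \<and> length fs' < length fs \<and>
        (\<forall>F\<in>fst sq. follows r (subst (spine_subst fs) F) (subst (spine_subst fs') F))"
proof -
  obtain us vs \<sigma> fs' where fs: "fs = Frame sq' r us vs \<sigma> # fs'"
    using assms by (cases "(fs, t)" rule: plug.cases) auto
  have ts: "ts = us @ plug fs' t # vs" using assms fs by simp
  have "ts ! i \<in> set us \<union> set vs" if "i \<noteq> length us"
  proof (cases "i < length us")
    case False
    then have "ts ! i = vs ! (i - Suc (length us))" "i - Suc (length us) < length vs"
      using that assms(4) by (auto simp: ts nth_append nth_Cons')
    then show ?thesis by simp
  qed (simp add: ts nth_append)
  then show ?thesis
    using assms(1) by (auto simp: fs ts side_tree_def)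
qed

locale subst_elimination =
  fixes S :: "('f, 'p, 'q) signature" and T :: "('f, 'p, 'q) dtree" and R :: "nat list \<Rightarrow> nat list"
  assumes cyclic: "cyclic_proof S T R"
begin

abbreviation "loc \<equiv> locate S T"

definition T' :: "('f, 'p, 'q) dtree" where "T' = elim_Subst S T"

text \<open>The value of \<open>R'\<close> matters only at buds, where the remaining spine is empty.\<close>

definition R' :: "nat list \<Rightarrow> nat list" where
  "R' p = (SOME p'. loc p' = Some (R (fst (the (loc p))), []) \<and> subtree T' p' \<noteq> None)"

lemma derivation_T: "derivation S T"
  using cyclic by (simp add: cyclic_proof_def pre_proof_def)

lemma derivation_at: "subtree T q = Some V \<Longrightarrow> derivation S V"
  using derivation_subtree derivation_T by metis

text \<open>The invariant relating the state read from \<open>p\<close> to the subtree found there.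
  Where there is no state, the absence of buds is enough to exclude infinite paths.\<close>

definition located :: "nat list \<Rightarrow> ('f, 'p, 'q) dtree \<Rightarrow> bool" where
  "located p U \<longleftrightarrow> (case loc p of
      None \<Rightarrow> bud_free U
    | Some (q, fs) \<Rightarrow> (\<exists>V. subtree T q = Some V \<and> U = plug fs (elim_Subst S V) \<and>
        spine S (root_seq V) fs))"

text \<open>There are three kinds of moves: within a spine the old position waits; at an ordinary
  node both trees move alike; at a \<open>Subst\<close> node the old tree moves to the premise while
  the new one enters the spine.\<close>

lemma located_child:
  assumes loc: "loc p = Some (q, fs)" and V: "subtree T q = Some V"
    and U: "Node sq r ts = plug fs (elim_Subst S V)" and sp: "spine S (root_seq V) fs"
    and i: "i < length ts"
  shows "located (p @ [i]) (ts ! i) \<and> (loc (p @ [i]) = Some (q', fs') \<longrightarrow>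
      fs \<noteq> [] \<and> q' = q \<and> length fs' < length fs \<and>
        (\<forall>F\<in>fst (root_seq V). follows r (subst (spine_subst fs) F) (subst (spine_subst fs') F)) \<or>
      fs = [] \<and> fs' = [] \<and> q' = q @ [i] \<and>
        (\<exists>us. V = Node sq r us \<and> length us = length ts \<and> subst_of r = None) \<or>
      fs = [] \<and> q' = q @ [0] \<and> (\<exists>sq' \<theta> t. V = Node sq' (Subst \<theta>) [t] \<and>
        (\<forall>F\<in>fst (root_seq t). follows r (subst \<theta> F) (subst (spine_subst fs') F))))"
proof (cases "fs = []")
  case False
  then have "loc (p @ [i]) = descend q fs i"
    using loc by (simp add: locate_snoc child_state_def)
  then show ?thesis
    using descend_child[OF sp U[symmetric] False i, of q] V False
    by (cases "descend q fs i") (auto simp: located_def)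
next
  case True
  then obtain sq0 r0 us where V0: "V = Node sq0 r0 us" using U by (cases V) auto
  show ?thesis
  proof (cases "subst_of r0")
    case None
    then have eq: "sq0 = sq" "r0 = r" "ts = map (elim_Subst S) us"
      using U True V0 by auto
    moreover have "loc (p @ [i]) = Some (q @ [i], [])"
      using loc True V V0 None by (simp add: locate_snoc child_state_def)
    ultimately show ?thesis
      using True V V0 i None by (auto simp: located_def subtree_snoc)
  next
    case (Some \<theta>)
    then have r0: "r0 = Subst \<theta>" by (simp add: subst_of_Some)
    obtain t where t: "us = [t]" "derivation S t" "wf_subst S \<theta>"
      using derivation_at[OF V] V0 r0 derivation_Subst by metis
    note ns = node_spine[OF wf_sequent_root[OF t(2)] t(3)]
    let ?fs = "node_spine S \<theta> (root_seq t)"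
    have l: "loc (p @ [i]) = descend (q @ [0]) ?fs i"
      using loc True V V0 Some t by (simp add: locate_snoc child_state_def)
    have "plug ?fs (elim_Subst S t) = Node sq r ts"
      using U True V0 r0 t by simp
    moreover have "subtree T (q @ [0]) = Some t" using V V0 t by (simp add: subtree_snoc)
    ultimately show ?thesis
      using descend_child[OF ns(2) _ ns(1) i, of "elim_Subst S t" sq r "q @ [0]"] ns(4) True l V0 r0 t(1)
      by (cases "descend (q @ [0]) ?fs i") (auto simp: located_def)
  qed
qed

lemma located_subtree: "subtree T' p = Some U \<Longrightarrow> located p U"
proof (induction p arbitrary: U rule: rev_induct)
  case Nil
  then show ?case by (simp add: located_def T'_def)
next
  case (snoc i p)
  then obtain sq r ts where p: "subtree T' p = Some (Node sq r ts)" and i: "i < length ts"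
    and U: "U = ts ! i"
    by (auto simp: subtree_snoc split: option.splits dtree.splits if_splits)
  have lp: "located p (Node sq r ts)" using snoc.IH[OF p] .
  show ?case
  proof (cases "loc p")
    case None
    then show ?thesis using lp i U by (simp add: located_def locate_snoc)
  next
    case (Some st)
    obtain q fs where "st = (q, fs)" by fastforce
    then show ?thesis using Some lp located_child[of p q fs _ sq r ts i] i U
      by (auto simp: located_def)
  qed
qed

text \<open>Climbing through the hole of each frame in turn leads to the top of the spine.\<close>

lemma locate_spine:
  "loc p = Some (q, fs) \<Longrightarrow> subtree T' p = Some (plug fs t) \<Longrightarrow>
    \<exists>p'. loc p' = Some (q, []) \<and> subtree T' p' = Some t"
proof (induction fs arbitrary: p)
  case (Cons f fs)
  obtain sq r us vs \<sigma> where f: "f = Frame sq r us vs \<sigma>" by (cases f)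
  have "loc (p @ [length us]) = Some (q, fs)" "subtree T' (p @ [length us]) = Some (plug fs t)"
    using Cons.prems by (simp_all add: f locate_snoc child_state_def subtree_snoc nth_append)
  then show ?case by (rule Cons.IH)
qed auto

text \<open>Old companions thus have counterparts in the new tree, as the choice in
  \<open>R'\<close> requires.\<close>

lemma locate_surj:
  "subtree T q = Some V \<Longrightarrow> \<exists>p. loc p = Some (q, []) \<and> subtree T' p = Some (elim_Subst S V)"
proof (induction q arbitrary: V rule: rev_induct)
  case Nil
  then have V: "V = T" by simp
  show ?case unfolding V T'_def[symmetric] by (intro exI[of _ "[]"]) simp
next
  case (snoc i q)
  then obtain sq r ts where q: "subtree T q = Some (Node sq r ts)" and i: "i < length ts"
    and V: "V = ts ! i"
    by (auto simp: subtree_snoc split: option.splits dtree.splits if_splits)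
  from snoc.IH[OF q] obtain p where p: "loc p = Some (q, [])"
    "subtree T' p = Some (elim_Subst S (Node sq r ts))" by blast
  show ?case
  proof (cases "subst_of r")
    case None
    then show ?thesis using p q i V
      by (intro exI[of _ "p @ [i]"]) (simp add: locate_snoc child_state_def subtree_snoc)
  next
    case (Some \<theta>)
    then have r: "r = Subst \<theta>" by (simp add: subst_of_Some)
    obtain t where t: "ts = [t]" "derivation S t" "wf_subst S \<theta>"
      using derivation_at[OF q] r derivation_Subst by metis
    then have [simp]: "i = 0" "V = t" using i V by auto
    obtain sq' r' us vs \<sigma> fs where fs: "node_spine S \<theta> (root_seq t) = Frame sq' r' us vs \<sigma> # fs"
      using node_spine(1)[OF wf_sequent_root[OF t(2)] t(3)] by (metis neq_Nil_conv frame.exhaust)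
    have "loc (p @ [length us]) = Some (q @ [i], fs)"
      "subtree T' (p @ [length us]) = Some (plug fs (elim_Subst S V))"
      using p q r t fs by (simp_all add: locate_snoc child_state_def subtree_snoc nth_append)
    then show ?thesis by (rule locate_spine)
  qed
qed

section \<open>Buds and companions of the new tree\<close>

lemma elim_eq_Bud:
  assumes V: "subtree T q = Some V" and "elim_Subst S V = Bud sq"
  shows "V = Bud sq"
proof (cases V)
  case (Node sq' r ts)
  show ?thesis
  proof (cases "subst_of r")
    case (Some \<theta>)
    then have r: "r = Subst \<theta>" by (simp add: subst_of_Some)
    obtain t where t: "ts = [t]" "derivation S t" "wf_subst S \<theta>"
      using derivation_at[OF V] r Node derivation_Subst by metis
    then show ?thesis
      using node_spine(1)[OF wf_sequent_root[OF t(2)] t(3)] assms(2) Node r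
      by (auto simp: plug_eq_Bud)
  qed (use Node assms in auto)
qed (use assms in auto)

text \<open>Side branches have no buds and a nonempty remaining spine starts with a node, so a new
  bud can only translate an old one.\<close>

lemma bud_T':
  assumes "subtree T' p = Some (Bud sq)"
  obtains q where "loc p = Some (q, [])" "subtree T q = Some (Bud sq)"
proof -
  have l: "located p (Bud sq)" using located_subtree[OF assms] .
  show thesis
  proof (cases "loc p")
    case None
    then show ?thesis using l by (simp add: located_def)
  next
    case (Some st)
    obtain q fs where st: "st = (q, fs)" by fastforce
    then obtain V where V: "subtree T q = Some V" "Bud sq = plug fs (elim_Subst S V)"
      using Some l by (auto simp: located_def)
    then have "fs = []" "elim_Subst S V = Bud sq" by (metis plug_eq_Bud)+
    then show ?thesis using that V elim_eq_Bud Some st by metis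
  qed
qed

lemma R'_bud:
  assumes "subtree T' p = Some (Bud sq)" and q: "loc p = Some (q, [])"
  obtains r ts where "loc (R' p) = Some (R q, [])" "subtree T (R q) = Some (Node sq r ts)"
    "subtree T' (R' p) = Some (elim_Subst S (Node sq r ts))"
proof -
  have "subtree T q = Some (Bud sq)" using assms bud_T' by fastforce
  then obtain r ts where c: "subtree T (R q) = Some (Node sq r ts)"
    using cyclic unfolding cyclic_proof_def pre_proof_def by blast
  have "\<exists>p'. loc p' = Some (R q, []) \<and> subtree T' p' \<noteq> None"
    using locate_surj[OF c] by auto
  from someI_ex[OF this] have *: "loc (R' p) = Some (R q, []) \<and> subtree T' (R' p) \<noteq> None"
    by (simp add: R'_def q)
  then obtain U where "subtree T' (R' p) = Some U" by auto
  with located_subtree[OF this] * c show thesis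
    by (intro that[of r ts]) (auto simp: located_def simp del: elim_Subst.simps)
qed

text \<open>Companions must have a premise; at a \<open>Subst\<close> node the hole of the first
  frame supplies one.\<close>

lemma elim_Node_nonempty:
  assumes V: "subtree T q = Some (Node sq r ts)" and "ts \<noteq> []"
  shows "\<exists>r' ts'. elim_Subst S (Node sq r ts) = Node sq r' ts' \<and> ts' \<noteq> []"
proof (cases "subst_of r")
  case (Some \<theta>)
  then have r: "r = Subst \<theta>" by (simp add: subst_of_Some)
  obtain t where t: "ts = [t]" "derivation S t" "wf_subst S \<theta>"
    using derivation_at[OF V] r derivation_Subst by metis
  obtain sq' r' us vs \<sigma> fs where fs: "node_spine S \<theta> (root_seq t) = Frame sq' r' us vs \<sigma> # fs"
    using node_spine(1)[OF wf_sequent_root[OF t(2)] t(3)] by (metis neq_Nil_conv frame.exhaust)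
  moreover have "root_seq (elim_Subst S (Node sq r ts)) = sq"
    using elim_Subst_correct[OF derivation_at[OF V]] by simp
  ultimately show ?thesis using r t by auto
qed (use assms in auto)

lemma pre_proof_T': "pre_proof S T' R'"
  unfolding pre_proof_def
proof (intro conjI allI impI)
  show "derivation S T'" using elim_Subst_correct[OF derivation_T] by (simp add: T'_def)
next
  fix p sq assume p: "subtree T' p = Some (Bud sq)"
  then obtain q where q: "loc p = Some (q, [])" "subtree T q = Some (Bud sq)" by (rule bud_T')
  obtain r ts where c: "subtree T (R q) = Some (Node sq r ts)"
    "subtree T' (R' p) = Some (elim_Subst S (Node sq r ts))"
    using R'_bud[OF p q(1)] by metis
  have "ts \<noteq> []"
    using cyclic q(2) c(1) unfolding cyclic_proof_def pre_proof_def by fastforce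
  then show "\<exists>r ts. subtree T' (R' p) = Some (Node sq r ts) \<and> ts \<noteq> []"
    using elim_Node_nonempty[OF c(1)] c(2) by auto
qed

section \<open>Transfer of traces\<close>

lemma ind_occurrence_T':
  assumes "loc p = Some (q, fs)" and "subtree T' p \<noteq> None" and "ind_occurrence T q F"
  shows "ind_occurrence T' p (subst (spine_subst fs) F)"
proof -
  obtain U where U: "subtree T' p = Some U" using assms by auto
  obtain V where V: "subtree T q = Some V" "U = plug fs (elim_Subst S V)" "spine S (root_seq V) fs"
    using located_subtree[OF U] assms(1) by (auto simp: located_def)
  have "root_seq U = spine_seq (root_seq V) fs"
    using elim_Subst_correct[OF derivation_at[OF V(1)]] V(2) by (simp add: root_seq_plug)
  then show ?thesis
    using assms(3) U V spine_subst_mem[OF V(3), of F] by (auto simp: ind_occurrence_def)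
qed

text \<open>One step of a simulation: either the old path waits while the spine shortens, or it
  takes an edge of its own. In the second case \<open>spine_subst fs\<close> is the identity, so
  \<open>F\<close> appears unchanged. The occurrence assumptions are there because a spine follows
  only antecedent formulas of its hole.\<close>

lemma edge_cases:
  assumes e: "edge T' R' p p'" and p: "loc p = Some (q, fs)" and p': "loc p' = Some (q', fs')"
  shows "fs \<noteq> [] \<and> q' = q \<and> length fs' < length fs \<and>
      (\<forall>F. ind_occurrence T q F \<longrightarrow>
        trace_step T' p p' (subst (spine_subst fs) F) (subst (spine_subst fs') F)) \<or>
    fs = [] \<and> edge T R q q' \<and>
      (\<forall>F F'. ind_occurrence T q' F' \<and> trace_step T q q' F F' \<longrightarrow>
        trace_step T' p p' F (subst (spine_subst fs') F')) \<and>
      (\<forall>F F'. progress_step T q q' F F' \<longrightarrow>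
        progress_step T' p p' F (subst (spine_subst fs') F'))"
  using e[unfolded edge_def]
proof (elim disjE exE conjE)
  fix sq assume b: "subtree T' p = Some (Bud sq)" and R': "p' = R' p"
  have fs: "fs = []" and q: "subtree T q = Some (Bud sq)"
    using bud_T'[OF b] p by auto
  have "q' = R q" "fs' = []" using R'_bud[OF b] p p' fs R' by auto
  then show ?thesis using fs q b by (auto simp: edge_def trace_step_def progress_step_def)
next
  fix sq r ts i assume n: "subtree T' p = Some (Node sq r ts)" and i: "i < length ts"
    and pi: "p' = p @ [i]"
  obtain V where V: "subtree T q = Some V" "Node sq r ts = plug fs (elim_Subst S V)"
    "spine S (root_seq V) fs"
    using located_subtree[OF n] p by (auto simp: located_def)
  from located_child[OF p V i] p' pi consider
    (spine) "fs \<noteq> []" "q' = q" "length fs' < length fs"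
        "\<forall>F\<in>fst (root_seq V). follows r (subst (spine_subst fs) F) (subst (spine_subst fs') F)"
    | (node) us where "fs = []" "fs' = []" "q' = q @ [i]" "V = Node sq r us"
        "length us = length ts" "subst_of r = None"
    | (subst) sq' \<theta> t where "fs = []" "q' = q @ [0]" "V = Node sq' (Subst \<theta>) [t]"
        "\<forall>F\<in>fst (root_seq t). follows r (subst \<theta> F) (subst (spine_subst fs') F)"
    by blast
  then show ?thesis
  proof cases
    case spine
    then show ?thesis using V(1) n by (auto simp: trace_step_def ind_occurrence_def)
  next
    case node
    then show ?thesis using V(1) n i pi
      by (auto simp: edge_def trace_step_def progress_step_def)
  next
    case subst
    have "subtree T q' = Some t" using subst V(1) by (simp add: subtree_snoc)
    then show ?thesis using subst V(1) n
      by (auto simp: edge_def trace_step_def progress_step_def ind_occurrence_def)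
  qed
qed

lemma global_trace_condition_T': "global_trace_condition T' R'"
  unfolding global_trace_condition_def
proof (intro allI impI)
  fix \<pi>' assume inf: "infinite_path T' R' \<pi>'"
  then have edge': "edge T' R' (\<pi>' n) (\<pi>' (Suc n))" for n by (simp add: infinite_path_def)
  then have valid: "\<exists>U. subtree T' (\<pi>' n) = Some U" for n
    unfolding edge_def by blast
  \<comment> \<open>Without a state the path would be inside a tree without buds and could not be
    infinite.\<close>
  have "\<exists>st. loc (\<pi>' n) = Some st" for n
  proof (rule ccontr)
    assume *: "\<nexists>st. loc (\<pi>' n) = Some st"
    obtain U where U: "subtree T' (\<pi>' n) = Some U" using valid by blast
    with located_subtree[OF U] * have "bud_free U"
      by (auto simp: located_def split: option.splits)
    then show False using bud_free_no_infinite_path[OF U _ inf] by simp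
  qed
  then obtain st where st: "\<And>n. loc (\<pi>' n) = Some (st n)" by metis
  define q where "q = (\<lambda>n. fst (st n))"
  define fs where "fs = (\<lambda>n. snd (st n))"
  have loc: "loc (\<pi>' n) = Some (q n, fs n)" for n by (simp add: st q_def fs_def)
  note step = edge_cases[OF edge' loc loc]
  \<comment> \<open>At these times the old path takes an edge; at all others it waits while the
    spine shortens, so every wait is finite.\<close>
  define A where "A = {n. fs n = []}"
  have inf_A: "\<exists>n\<ge>m. n \<in> A" for m
  proof (induction "length (fs m)" arbitrary: m rule: less_induct)
    case less
    show ?case
    proof (cases "fs m = []")
      case False
      then have "length (fs (Suc m)) < length (fs m)" using step[of m] by blast
      then show ?thesis using less Suc_leD by blast
    qed (auto simp: A_def)
  qed
  have stutter: "q (Suc n) = q n" if "n \<notin> A" for n using step[of n] that by (simp add: A_def)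
  obtain idx \<pi> where \<pi>: "\<And>n. \<pi> (idx n) = q n"
    and idx_Suc: "\<And>n. idx (Suc n) = (if n \<in> A then Suc (idx n) else idx n)"
    and idx_surj: "\<And>k. \<exists>n\<in>A. idx n = k"
    using destutter[of A q, OF inf_A stutter] by metis
  have idx_mono: "idx m \<le> idx n" if "m \<le> n" for m n
    using that by (rule lift_Suc_mono_le[of idx, rotated]) (auto simp: idx_Suc)
  have "infinite_path T R \<pi>"
    unfolding infinite_path_def
  proof
    fix k
    obtain n where n: "n \<in> A" "idx n = k" using idx_surj by blast
    then have "\<pi> k = q n" "\<pi> (Suc k) = q (Suc n)"
      using \<pi>[of n] \<pi>[of "Suc n"] by (auto simp: idx_Suc)
    then show "edge T R (\<pi> k) (\<pi> (Suc k))" using step[of n] n(1) by (simp add: A_def)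
  qed
  then obtain k \<tau> where tr: "trace T (\<lambda>n. \<pi> (k + n)) \<tau>"
    and pr: "infinitely_progressing T (\<lambda>n. \<pi> (k + n)) \<tau>"
    using cyclic unfolding cyclic_proof_def global_trace_condition_def by blast
  \<comment> \<open>From time \<open>N\<close>, when the old path has reached the start of its
    trace, \<open>j n\<close> counts the further moves of the old path.\<close>
  obtain N where N: "idx N = k" using idx_surj by blast
  define j where "j = (\<lambda>n. idx (N + n) - k)"
  have k_le: "k \<le> idx (N + n)" for n using idx_mono[of N "N + n"] N by simp
  then have \<pi>_j: "\<pi> (k + j n) = q (N + n)" for n using \<pi> by (simp add: j_def)
  have j_Suc: "j (Suc n) = (if N + n \<in> A then Suc (j n) else j n)" for n
    using k_le[of n] by (simp add: j_def idx_Suc Suc_diff_le)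
  \<comment> \<open>\<open>\<tau> (j n)\<close> occurs in the sequent in the hole; the substitution
    carries it down to the frame where the new path stands.\<close>
  define \<tau>' where "\<tau>' = (\<lambda>n. subst (spine_subst (fs (N + n))) (\<tau> (j n)))"
  have occ: "ind_occurrence T (q (N + n)) (\<tau> (j n))" for n
    using tr \<pi>_j[of n] unfolding trace_def by metis
  have "trace T' (\<lambda>n. \<pi>' (N + n)) \<tau>'"
    unfolding trace_def
  proof (intro allI conjI)
    fix n
    show "ind_occurrence T' (\<pi>' (N + n)) (\<tau>' n)"
      unfolding \<tau>'_def using ind_occurrence_T'[OF loc _ occ] valid by fastforce
    show "trace_step T' (\<pi>' (N + n)) (\<pi>' (N + Suc n)) (\<tau>' n) (\<tau>' (Suc n))"
    proof (cases "N + n \<in> A")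
      case True
      then have "trace_step T (q (N + n)) (q (N + Suc n)) (\<tau> (j n)) (\<tau> (j (Suc n)))"
        using tr \<pi>_j[of n] \<pi>_j[of "Suc n"] by (metis add_Suc_right j_Suc trace_def)
      then show ?thesis
        using step[of "N + n"] True occ[of "Suc n"] by (simp add: A_def \<tau>'_def)
    next
      case False
      then show ?thesis
        using step[of "N + n"] occ[of n] by (simp add: A_def \<tau>'_def j_Suc)
    qed
  qed
  moreover have "infinitely_progressing T' (\<lambda>n. \<pi>' (N + n)) \<tau>'"
    unfolding infinitely_progressing_def INFM_nat_le
  proof
    fix m
    obtain i where i: "i \<ge> j m" "progress_step T (\<pi> (k + i)) (\<pi> (k + Suc i)) (\<tau> i) (\<tau> (Suc i))"
      using pr unfolding infinitely_progressing_def INFM_nat_le by blast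
    \<comment> \<open>The time at which the new path performs step \<open>k + i\<close> of the old
      one; \<open>i \<ge> j m\<close> keeps it from preceding \<open>N + m\<close>.\<close>
    obtain n0 where n0: "n0 \<in> A" "idx n0 = k + i" using idx_surj by blast
    have "N + m \<le> n0"
    proof (rule ccontr)
      assume "\<not> N + m \<le> n0"
      then have "idx (Suc n0) \<le> idx (N + m)" by (intro idx_mono) simp
      then show False using n0 i(1) k_le[of m] by (simp add: idx_Suc j_def)
    qed
    then obtain n where n: "n0 = N + n" "m \<le> n" by (metis le_add1 le_Suc_ex add.assoc nat_add_left_cancel_le)
    then have "j n = i" "j (Suc n) = Suc i" using n0 by (auto simp: j_def idx_Suc)
    then have "progress_step T (q (N + n)) (q (N + Suc n)) (\<tau> (j n)) (\<tau> (j (Suc n)))"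
      using i(2) \<pi>_j[of n] \<pi>_j[of "Suc n"] by metis
    then have "progress_step T' (\<pi>' (N + n)) (\<pi>' (N + Suc n)) (\<tau>' n) (\<tau>' (Suc n))"
      using step[of "N + n"] n0(1) n(1) by (simp add: A_def \<tau>'_def)
    then show "\<exists>n\<ge>m. progress_step T' (\<pi>' (N + n)) (\<pi>' (N + Suc n)) (\<tau>' n) (\<tau>' (Suc n))"
      using n(2) by blast
  qed
  ultimately show "\<exists>k \<tau>. trace T' (\<lambda>n. \<pi>' (k + n)) \<tau> \<and>
      infinitely_progressing T' (\<lambda>n. \<pi>' (k + n)) \<tau>"
    by blast
qed

end

theorem theorem2:
  fixes S :: "('f, 'p, 'q) signature"
    and \<Gamma> \<Delta> :: "('f, 'p, 'q) fm set"
  assumes "wf_signature S"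
    and "provable S (\<Gamma>, \<Delta>)"
  shows "provable_without_Subst S (\<Gamma>, \<Delta>)"
proof -
  obtain T R where T: "cyclic_proof S T R" "root_seq T = (\<Gamma>, \<Delta>)"
    using assms(2) unfolding provable_def by blast
  interpret subst_elimination S T R by unfold_locales (rule T(1))
  have "cyclic_proof S T' R'"
    using pre_proof_T' global_trace_condition_T' by (simp add: cyclic_proof_def)
  moreover have "root_seq T' = (\<Gamma>, \<Delta>)" "\<forall>\<theta>. Subst \<theta> \<notin> rules_of T'"
    using elim_Subst_correct[OF derivation_T] T(2) by (simp_all add: T'_def)
  ultimately show ?thesis unfolding provable_without_Subst_def by blast
qed

end
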